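(* Let $\mathfrak g$ be the $11$-dimensional nilpotent real Lie algebra with basis $\{e_1,\dots,e_{11}\}$ whose dual basis $\{e^1,\dots,e^{11}\}$ satisfies $$(de^1,\dots,de^{11})=\bigl(0,\;0,\;-e^{12},\;0,\;\tfrac12 e^{24},\;e^{13}-\tfrac12 e^{24},\;e^{14}-e^{23},\;-2e^{16}+e^{27},\;e^{26}-e^{17}+e^{25},\;e^{18}-e^{46}-e^{37}-e^{45},\;e^{28}-2e^{36}-e^{47}\bigr).$$ Then $\mathfrak g$ has an ad-invariant metric $$g=-e^1\odot e^{11}+e^3\odot e^8+e^4\odot e^9+e^2\odot e^{10}-2e^5\otimes e^5+2e^6\otimes e^6+e^7\otimes e^7,$$ and $\mathfrak g$ does not admit any nice basis.
   Context: Notation: $d$ is the Chevalley–Eilenberg differential, $de^k(X,Y)=-e^k([X,Y])$; $e^{ij}$ denotes $e^i\wedge e^j$; $a\odot b=a\otimes b+b\otimes a$. An ad-invariant metric on a Lie algebra is a nondegenerate symmetric bilinear form $g$ (any signature) with $g([X,Y],Z)=-g(Y,[X,Z])$ for all $X,Y,Z$. A nice basis of a Lie algebra is a basis $\{f_1,\dots,f_n\}$ with dual basis $\{f^1,\dots,f^n\}$ such that each $[f_i,f_j]$ is a (possibly zero) multiple of a basis element and each interior product $f_i\lrcorner\, df^j$ is a (possibly zero) multiple of an element of the dual basis. *)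

theory Defs
  imports "HOL-Analysis.Analysis"
begin

text \<open>A Lie algebra structure on a real vector space (the whole type) is given by its bracket.\<close>

definition alternating_bracket :: "('a::real_vector \<Rightarrow> 'a \<Rightarrow> 'a) \<Rightarrow> bool" where
  "alternating_bracket br \<longleftrightarrow> bilinear br \<and> (\<forall>x. br x x = 0)"

definition lie_algebra :: "('a::real_vector \<Rightarrow> 'a \<Rightarrow> 'a) \<Rightarrow> bool" where
  "lie_algebra br \<longleftrightarrow> alternating_bracket br \<and>
     (\<forall>x y z. br x (br y z) + br y (br z x) + br z (br x y) = 0)"

fun lower_central :: "('a::real_vector \<Rightarrow> 'a \<Rightarrow> 'a) \<Rightarrow> nat \<Rightarrow> 'a set" where
  "lower_central br 0 = UNIV"
| "lower_central br (Suc k) = span {br x y | x y. y \<in> lower_central br k}"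

definition nilpotent_lie_algebra :: "('a::real_vector \<Rightarrow> 'a \<Rightarrow> 'a) \<Rightarrow> bool" where
  "nilpotent_lie_algebra br \<longleftrightarrow> lie_algebra br \<and> (\<exists>k. lower_central br k = {0})"

text \<open>Bases are families indexed by \<open>1, \<dots>, n\<close>; values at other indices are irrelevant.\<close>

definition indexed_basis :: "nat \<Rightarrow> (nat \<Rightarrow> 'a::real_vector) \<Rightarrow> bool" where
  "indexed_basis n f \<longleftrightarrow>
     inj_on f {1..n} \<and> independent (f ` {1..n}) \<and> span (f ` {1..n}) = UNIV"

definition dual_basis :: "nat \<Rightarrow> (nat \<Rightarrow> 'a::real_vector) \<Rightarrow> nat \<Rightarrow> 'a \<Rightarrow> real" where
  "dual_basis n f k = (\<lambda>x. representation (f ` {1..n}) x (f k))"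

text \<open>Covectors are functions \<open>'a \<Rightarrow> real\<close>, bilinear forms and 2-forms are curried functions
  of two vectors. The wedge product carries no factor 1/2.\<close>

definition tensor :: "('a \<Rightarrow> real) \<Rightarrow> ('a \<Rightarrow> real) \<Rightarrow> 'a \<Rightarrow> 'a \<Rightarrow> real" where
  "tensor a b = (\<lambda>X Y. a X * b Y)"

definition wedge :: "('a \<Rightarrow> real) \<Rightarrow> ('a \<Rightarrow> real) \<Rightarrow> 'a \<Rightarrow> 'a \<Rightarrow> real" where
  "wedge a b = (\<lambda>X Y. tensor a b X Y - tensor b a X Y)"

definition sym_product :: "('a \<Rightarrow> real) \<Rightarrow> ('a \<Rightarrow> real) \<Rightarrow> 'a \<Rightarrow> 'a \<Rightarrow> real" where
  "sym_product a b = (\<lambda>X Y. tensor a b X Y + tensor b a X Y)"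

definition ce_diff :: "('a \<Rightarrow> 'a \<Rightarrow> 'a) \<Rightarrow> ('a \<Rightarrow> real) \<Rightarrow> 'a \<Rightarrow> 'a \<Rightarrow> real" where
  "ce_diff br a = (\<lambda>X Y. - a (br X Y))"

definition interior_product :: "'a \<Rightarrow> ('a \<Rightarrow> 'a \<Rightarrow> real) \<Rightarrow> 'a \<Rightarrow> real" where
  "interior_product X w = (\<lambda>Y. w X Y)"

definition ad_invariant_metric ::
  "('a::real_vector \<Rightarrow> 'a \<Rightarrow> 'a) \<Rightarrow> ('a \<Rightarrow> 'a \<Rightarrow> real) \<Rightarrow> bool" where
  "ad_invariant_metric br g \<longleftrightarrow>
     bilinear g \<and> (\<forall>X Y. g X Y = g Y X) \<and>
     (\<forall>X. (\<forall>Y. g X Y = 0) \<longrightarrow> X = 0) \<and>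
     (\<forall>X Y Z. g (br X Y) Z = - g Y (br X Z))"

definition nice_basis ::
  "('a::real_vector \<Rightarrow> 'a \<Rightarrow> 'a) \<Rightarrow> nat \<Rightarrow> (nat \<Rightarrow> 'a) \<Rightarrow> bool" where
  "nice_basis br n f \<longleftrightarrow>
     indexed_basis n f \<and>
     (\<forall>i\<in>{1..n}. \<forall>j\<in>{1..n}. \<exists>k\<in>{1..n}. \<exists>c. br (f i) (f j) = c *\<^sub>R f k) \<and>
     (\<forall>i\<in>{1..n}. \<forall>j\<in>{1..n}. \<exists>k\<in>{1..n}. \<exists>c.
        interior_product (f i) (ce_diff br (dual_basis n f j)) = (\<lambda>Y. c * dual_basis n f k Y))"

end

theory Submission
  imports Defs
begin

text \<open>
  Nilpotency, the Jacobi identity and the properties of the metric are polynomial identities in the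
  coordinates \<open>\<epsilon> 1 x, \<dots>, \<epsilon> 11 x\<close>. The content is the absence of a nice basis.

  The two conditions on a nice basis \<open>f\<close> say that every \<open>ad (f i)\<close> sends basis elements to
  multiples of basis elements, and no two basis elements into the same nonzero line. Hence images
  and preimages under brackets of a subspace spanned by part of \<open>f\<close> are again spanned by part of
  \<open>f\<close>; in particular so are all terms of the lower and the upper central series
  (\<open>coordinate_subspace_lower_central\<close>, \<open>coordinate_subspace_upper_central\<close>).

  Write \<open>Z k\<close> for the upper and \<open>L k\<close> for the lower central series. Here
  \<open>Z 2 = \<langle>e 5, e 8, \<dots>, e 11\<rangle>\<close>, \<open>Z 4 = \<langle>e 3, \<dots>, e 11\<rangle>\<close>, \<open>L 2\<close> contains \<open>e 6\<close> and \<open>e 7\<close> and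
  lies in the hyperplane \<open>\<epsilon> 5 = 0\<close>. Some basis element \<open>f r\<close> of \<open>Z 4\<close> has the form
  \<open>u e 3 + c e 4 + \<dots>\<close> with \<open>c \<noteq> 0\<close>. If \<open>f p\<close> has a nonzero component \<open>b\<close> along \<open>e 2\<close> and \<open>a\<close> along
  \<open>e 1\<close>, then \<open>[f p, f r]\<close> has a component along \<open>e 5\<close>, so, being a multiple of a basis element of
  \<open>Z 2 + L 2\<close>, it must lie in \<open>Z 2\<close> (\<open>nice_basis_second_center_member\<close>). Since \<open>[e 2, e 4]\<close> is
  proportional to \<open>e 6 - e 5\<close>, this forces \<open>b u = a c\<close> and \<open>b c = 2 a u\<close>
  (\<open>nice_basis_slope\<close>), so \<open>u \<noteq> 0\<close> and \<open>f r\<close> determines the ratio \<open>a : b\<close>. A second basis element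
  \<open>f q\<close>, independent of \<open>f p\<close> modulo \<open>Z 4\<close>, can therefore have no component along \<open>e 2\<close>. Let \<open>f s\<close> be the basis
  element proportional to \<open>[f p, f q]\<close>; it is a multiple of \<open>e 3\<close> modulo \<open>Z 3\<close>. Then \<open>[f q, f s]\<close>,
  \<open>[f q, f r]\<close> and \<open>[f p, f s]\<close> lie in \<open>Z 3\<close>, and their \<open>(e 6, e 7)\<close> components are proportional to
  \<open>(1, 0)\<close>, \<open>(u, c)\<close> and \<open>(- u, c)\<close>. They are multiples of basis elements, and the first basis
  element differs from the other two. A linear relation between the three vectors in the plane thus
  puts that first basis element into \<open>Z 2\<close>, where it does not belong.
\<close>

section \<open>Coordinates with respect to an indexed basis\<close>

lemma linear_dual_basis:
  assumes "indexed_basis n f"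
  shows "linear (dual_basis n f k)"
  using assms unfolding indexed_basis_def dual_basis_def
  by (auto intro!: linearI simp: representation_add representation_scale)

lemma dual_basis_basis:
  assumes "indexed_basis n f" "j \<in> {1..n}" "k \<in> {1..n}"
  shows "dual_basis n f k (f j) = (if j = k then 1 else 0)"
proof -
  have "f k = f j \<longleftrightarrow> j = k"
    using assms unfolding indexed_basis_def by (metis inj_onD)
  moreover have "representation (f ` {1..n}) (f j) = (\<lambda>b. if b = f j then 1 else 0)"
    using assms unfolding indexed_basis_def by (intro representation_basis) auto
  ultimately show ?thesis unfolding dual_basis_def by simp
qed

lemma dual_basis_expansion:
  assumes "indexed_basis n f"
  shows "(\<Sum>k\<in>{1..n}. dual_basis n f k x *\<^sub>R f k) = x"
proof -
  have "(\<Sum>k\<in>{1..n}. dual_basis n f k x *\<^sub>R f k)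
      = (\<Sum>b\<in>f ` {1..n}. representation (f ` {1..n}) x b *\<^sub>R b)"
    using assms unfolding indexed_basis_def dual_basis_def
    by (simp add: sum.reindex)
  also have "\<dots> = x"
    using assms unfolding indexed_basis_def
    by (intro sum_representation_eq) auto
  finally show ?thesis .
qed

lemma linear_nonzero_on_basis:
  fixes h :: "'a::real_vector \<Rightarrow> real"
  assumes "indexed_basis n f" "linear h" "h x \<noteq> 0"
  obtains k where "k \<in> {1..n}" "dual_basis n f k x \<noteq> 0" "h (f k) \<noteq> 0"
proof -
  have "h x = (\<Sum>k\<in>{1..n}. dual_basis n f k x *\<^sub>R h (f k))"
    by (subst dual_basis_expansion[OF assms(1), of x, symmetric])
      (simp add: linear_sum[OF assms(2)] linear_scale[OF assms(2)])
  with assms(3) obtain k where "k \<in> {1..n}" "dual_basis n f k x *\<^sub>R h (f k) \<noteq> 0"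
    by (metis (lifting) sum.not_neutral_contains_not_neutral)
  then show thesis using that[of k] by auto
qed

section \<open>Coordinate subspaces of a nice basis\<close>

text \<open>A subspace spanned by part of the basis \<open>f\<close>, in the form in which it is used: every basis
  element that occurs in the expansion of an element of \<open>S\<close> lies in \<open>S\<close> itself.\<close>

definition coordinate_subspace :: "nat \<Rightarrow> (nat \<Rightarrow> 'a::real_vector) \<Rightarrow> 'a set \<Rightarrow> bool" where
  "coordinate_subspace n f S \<longleftrightarrow>
     subspace S \<and> (\<forall>x\<in>S. \<forall>k\<in>{1..n}. dual_basis n f k x \<noteq> 0 \<longrightarrow> f k \<in> S)"

text \<open>The contraction of \<open>f i\<close> with the differential of the \<open>j\<close>-th dual basis element is a multiple
  of one dual basis element, which vanishes on all basis vectors but one.\<close>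

lemma nice_basis_interior_unique:
  assumes "nice_basis br n f"
    and "i \<in> {1..n}" "j \<in> {1..n}" "k \<in> {1..n}" "l \<in> {1..n}"
    and "dual_basis n f j (br (f i) (f k)) \<noteq> 0" "dual_basis n f j (br (f i) (f l)) \<noteq> 0"
  shows "k = l"
proof -
  have bas: "indexed_basis n f" using assms(1) by (simp add: nice_basis_def)
  obtain m c where m: "m \<in> {1..n}" and
    "interior_product (f i) (ce_diff br (dual_basis n f j)) = (\<lambda>Y. c * dual_basis n f m Y)"
    using assms(1-3) unfolding nice_basis_def by blast
  then have eq: "- dual_basis n f j (br (f i) Y) = c * dual_basis n f m Y" for Y
    unfolding interior_product_def ce_diff_def by metis
  have "dual_basis n f m (f k) \<noteq> 0" "dual_basis n f m (f l) \<noteq> 0"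
    using eq[of "f k"] eq[of "f l"] assms(6,7) by auto
  then show ?thesis
    using dual_basis_basis[OF bas assms(4) m] dual_basis_basis[OF bas assms(5) m]
    by (auto split: if_splits)
qed

text \<open>If \<open>f k\<close> occurs in a bracket with an element of \<open>S\<close>, it occurs in some \<open>[f i, f j]\<close> with
  \<open>f j\<close> in \<open>S\<close>. That bracket is a multiple of one basis element, which must then be \<open>f k\<close>.\<close>

lemma coordinate_subspace_bracket_span:
  assumes nice: "nice_basis br n f" and bil: "bilinear br"
    and S: "coordinate_subspace n f S"
  shows "coordinate_subspace n f (span {br x y | x y. y \<in> S})" (is "coordinate_subspace n f ?T")
proof -
  have bas: "indexed_basis n f" using nice by (simp add: nice_basis_def)
  have "\<forall>k\<in>{1..n}. dual_basis n f k v \<noteq> 0 \<longrightarrow> f k \<in> ?T" if "v \<in> ?T" for v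
    using that
  proof (induction v rule: span_induct_alt)
    case base
    show ?case using linear_0[OF linear_dual_basis[OF bas]] by simp
  next
    case (step c v w)
    then obtain x y where v: "v = br x y" and y: "y \<in> S" by blast
    have lin: "dual_basis n f k (c *\<^sub>R v + w) = c * dual_basis n f k v + dual_basis n f k w" for k
      by (simp add: linear_add[OF linear_dual_basis[OF bas]] linear_scale[OF linear_dual_basis[OF bas]])
    have "f k \<in> ?T" if k: "k \<in> {1..n}" and nz: "dual_basis n f k (br x y) \<noteq> 0" for k
    proof -
      have "linear (\<lambda>u. dual_basis n f k (br u y))" "linear (\<lambda>u. dual_basis n f k (br z u))" for z
        using bil linear_dual_basis[OF bas, of k] unfolding bilinear_def
        by (auto intro: linear_compose[unfolded o_def])
      with nz obtain i j where i: "i \<in> {1..n}" and j: "j \<in> {1..n}"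
        and yj: "dual_basis n f j y \<noteq> 0" and nz': "dual_basis n f k (br (f i) (f j)) \<noteq> 0"
        by (metis linear_nonzero_on_basis[OF bas])
      obtain m c where m: "m \<in> {1..n}" and c: "br (f i) (f j) = c *\<^sub>R f m"
        using nice i j unfolding nice_basis_def by blast
      have "c \<noteq> 0 \<and> m = k"
        using nz' dual_basis_basis[OF bas m k]
        unfolding c by (auto simp: linear_scale[OF linear_dual_basis[OF bas]] split: if_splits)
      then have "f k = (1 / c) *\<^sub>R br (f i) (f j)" using c by simp
      moreover have "f j \<in> S" using S y j yj unfolding coordinate_subspace_def by blast
      then have "br (f i) (f j) \<in> ?T" by (intro span_base) blast
      ultimately show ?thesis by (simp only: span_scale)
    qed
    then show ?case using step.IH lin v by auto
  qed
  then show ?thesis unfolding coordinate_subspace_def by (simp add: subspace_span)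
qed

lemma coordinate_subspace_lower_central:
  assumes "nice_basis br n f" "bilinear br"
  shows "coordinate_subspace n f (lower_central br k)"
proof (induction k)
  case 0
  show ?case by (simp add: coordinate_subspace_def)
next
  case (Suc k)
  then show ?case using coordinate_subspace_bracket_span[OF assms] by simp
qed

text \<open>The varying vector \<open>y\<close> stands in the first argument, where the interior product of the nice
  basis condition also inserts its vector.\<close>

fun upper_central :: "('a::real_vector \<Rightarrow> 'a \<Rightarrow> 'a) \<Rightarrow> nat \<Rightarrow> 'a set" where
  "upper_central br 0 = {0}"
| "upper_central br (Suc k) = {x. \<forall>y. br y x \<in> upper_central br k}"

text \<open>Here uniqueness in the second nice condition prevents cancellation: if \<open>[f i, f k]\<close> is a nonzero
  multiple of \<open>f j\<close>, then only the \<open>f k\<close> component of \<open>x\<close> contributes to the \<open>f j\<close> component of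
  \<open>[f i, x]\<close>, so \<open>f j\<close> occurs in \<open>[f i, x]\<close> whenever \<open>f k\<close> occurs in \<open>x\<close>.\<close>

lemma coordinate_subspace_bracket_preimage:
  assumes nice: "nice_basis br n f" and bil: "bilinear br"
    and S: "coordinate_subspace n f S"
  shows "coordinate_subspace n f {x. \<forall>y. br y x \<in> S}"
proof -
  have bas: "indexed_basis n f" using nice by (simp add: nice_basis_def)
  have subS: "subspace S" using S by (simp add: coordinate_subspace_def)
  have lin1: "linear (\<lambda>u. br u x)" and lin2: "linear (br x)" for x
    using bil by (auto simp: bilinear_def)
  have "subspace {x. \<forall>y. br y x \<in> S}"
    using subS unfolding subspace_def
    by (auto simp: linear_0[OF lin2] linear_add[OF lin2] linear_scale[OF lin2])
  moreover have "br y (f k) \<in> S"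
    if x: "\<forall>y. br y x \<in> S" and k: "k \<in> {1..n}" and nz: "dual_basis n f k x \<noteq> 0" for x k y
  proof -
    have "br (f i) (f k) \<in> S" if i: "i \<in> {1..n}" for i
    proof -
      obtain j c where j: "j \<in> {1..n}" and c: "br (f i) (f k) = c *\<^sub>R f j"
        using nice i k unfolding nice_basis_def by blast
      show ?thesis
      proof (cases "c = 0")
        case True
        then show ?thesis using c subS by (simp add: subspace_0)
      next
        case False
        have lin: "linear (\<lambda>u. dual_basis n f j (br (f i) u))"
          using linear_compose[OF lin2 linear_dual_basis[OF bas]] by (simp add: o_def)
        have ck: "dual_basis n f j (br (f i) (f k)) = c"
          unfolding c using dual_basis_basis[OF bas j j]
          by (simp add: linear_scale[OF linear_dual_basis[OF bas]])
        have zero: "dual_basis n f j (br (f i) (f l)) = 0" if "l \<in> {1..n}" "l \<noteq> k" for l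
          using nice_basis_interior_unique[OF nice i j k that(1)] ck False that(2) by auto
        have "dual_basis n f j (br (f i) x)
            = (\<Sum>l\<in>{1..n}. dual_basis n f l x *\<^sub>R dual_basis n f j (br (f i) (f l)))"
          by (subst dual_basis_expansion[OF bas, of x, symmetric])
            (simp add: linear_sum[OF lin] linear_scale[OF lin])
        also have "\<dots> = (\<Sum>l\<in>{k}. dual_basis n f l x *\<^sub>R dual_basis n f j (br (f i) (f l)))"
          using k zero by (intro sum.mono_neutral_right) auto
        finally have "dual_basis n f j (br (f i) x) \<noteq> 0" using ck nz False by simp
        then have "f j \<in> S" using S x j unfolding coordinate_subspace_def by blast
        then show ?thesis unfolding c using subS by (simp add: subspace_scale)
      qed
    qed
    then have "(\<Sum>i\<in>{1..n}. dual_basis n f i y *\<^sub>R br (f i) (f k)) \<in> S"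
      using subS by (intro subspace_sum subspace_scale)
    also have "(\<Sum>i\<in>{1..n}. dual_basis n f i y *\<^sub>R br (f i) (f k)) = br y (f k)"
      by (subst (2) dual_basis_expansion[OF bas, of y, symmetric])
        (simp add: linear_sum[OF lin1] linear_scale[OF lin1])
    finally show ?thesis .
  qed
  ultimately show ?thesis unfolding coordinate_subspace_def by blast
qed

lemma coordinate_subspace_upper_central:
  assumes "nice_basis br n f" "bilinear br"
  shows "coordinate_subspace n f (upper_central br k)"
proof (induction k)
  case 0
  have "indexed_basis n f" using assms(1) by (simp add: nice_basis_def)
  then show ?case using linear_0[OF linear_dual_basis]
    by (auto simp: coordinate_subspace_def)
next
  case (Suc k)
  then show ?case using coordinate_subspace_bracket_preimage[OF assms] by simp
qed

section \<open>The eleven-dimensional algebra in coordinates\<close>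

text \<open>The structure equations, with the exterior derivatives unfolded into coordinates of the
  bracket: a term of \<open>d (\<epsilon> k)\<close> appears with the opposite sign in \<open>\<epsilon> k (br x y)\<close>.\<close>

locale metric_lie_algebra_11 =
  fixes br :: "'a::real_vector \<Rightarrow> 'a \<Rightarrow> 'a"
    and e :: "nat \<Rightarrow> 'a"
    and \<epsilon> :: "nat \<Rightarrow> 'a \<Rightarrow> real"
  assumes alternating: "alternating_bracket br"
    and basis: "indexed_basis 11 e"
    and dual: "\<epsilon> = dual_basis 11 e"
    and bracket:
      "\<epsilon> 1 (br x y) = 0"
      "\<epsilon> 2 (br x y) = 0"
      "\<epsilon> 3 (br x y) = \<epsilon> 1 x * \<epsilon> 2 y - \<epsilon> 2 x * \<epsilon> 1 y"
      "\<epsilon> 4 (br x y) = 0"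
      "\<epsilon> 5 (br x y) = - 1/2 * (\<epsilon> 2 x * \<epsilon> 4 y - \<epsilon> 4 x * \<epsilon> 2 y)"
      "\<epsilon> 6 (br x y) = - (\<epsilon> 1 x * \<epsilon> 3 y - \<epsilon> 3 x * \<epsilon> 1 y) + 1/2 * (\<epsilon> 2 x * \<epsilon> 4 y - \<epsilon> 4 x * \<epsilon> 2 y)"
      "\<epsilon> 7 (br x y) = - (\<epsilon> 1 x * \<epsilon> 4 y - \<epsilon> 4 x * \<epsilon> 1 y) + (\<epsilon> 2 x * \<epsilon> 3 y - \<epsilon> 3 x * \<epsilon> 2 y)"
      "\<epsilon> 8 (br x y) = 2 * (\<epsilon> 1 x * \<epsilon> 6 y - \<epsilon> 6 x * \<epsilon> 1 y) - (\<epsilon> 2 x * \<epsilon> 7 y - \<epsilon> 7 x * \<epsilon> 2 y)"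
      "\<epsilon> 9 (br x y) = - (\<epsilon> 2 x * \<epsilon> 6 y - \<epsilon> 6 x * \<epsilon> 2 y) + (\<epsilon> 1 x * \<epsilon> 7 y - \<epsilon> 7 x * \<epsilon> 1 y)
         - (\<epsilon> 2 x * \<epsilon> 5 y - \<epsilon> 5 x * \<epsilon> 2 y)"
      "\<epsilon> 10 (br x y) = - (\<epsilon> 1 x * \<epsilon> 8 y - \<epsilon> 8 x * \<epsilon> 1 y) + (\<epsilon> 4 x * \<epsilon> 6 y - \<epsilon> 6 x * \<epsilon> 4 y)
         + (\<epsilon> 3 x * \<epsilon> 7 y - \<epsilon> 7 x * \<epsilon> 3 y) + (\<epsilon> 4 x * \<epsilon> 5 y - \<epsilon> 5 x * \<epsilon> 4 y)"
      "\<epsilon> 11 (br x y) = - (\<epsilon> 2 x * \<epsilon> 8 y - \<epsilon> 8 x * \<epsilon> 2 y) + 2 * (\<epsilon> 3 x * \<epsilon> 6 y - \<epsilon> 6 x * \<epsilon> 3 y)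
         + (\<epsilon> 4 x * \<epsilon> 7 y - \<epsilon> 7 x * \<epsilon> 4 y)"
begin

(* Keeps the index 1 in the form in which it occurs in the equations of the locale. *)
declare One_nat_def [simp del]

lemma bilinear_bracket: "bilinear br"
  using alternating by (simp add: alternating_bracket_def)

lemma linear_eps: "linear (\<epsilon> k)"
  using linear_dual_basis[OF basis] by (simp add: dual)

lemmas eps_linear = linear_0[OF linear_eps] linear_add[OF linear_eps] linear_scale[OF linear_eps]
  linear_diff[OF linear_eps] linear_neg[OF linear_eps]

lemma eps_e: "j \<in> {1..11} \<Longrightarrow> k \<in> {1..11} \<Longrightarrow> \<epsilon> k (e j) = (if j = k then 1 else 0)"
  using dual_basis_basis[OF basis] by (simp add: dual)

lemma eq_iff_coords:
  "x = y \<longleftrightarrow> \<epsilon> 1 x = \<epsilon> 1 y \<and> \<epsilon> 2 x = \<epsilon> 2 y \<and> \<epsilon> 3 x = \<epsilon> 3 y \<and> \<epsilon> 4 x = \<epsilon> 4 y \<and> \<epsilon> 5 x = \<epsilon> 5 y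
     \<and> \<epsilon> 6 x = \<epsilon> 6 y \<and> \<epsilon> 7 x = \<epsilon> 7 y \<and> \<epsilon> 8 x = \<epsilon> 8 y \<and> \<epsilon> 9 x = \<epsilon> 9 y \<and> \<epsilon> 10 x = \<epsilon> 10 y
     \<and> \<epsilon> 11 x = \<epsilon> 11 y" (is "_ \<longleftrightarrow> ?R")
proof
  assume R: ?R
  have "\<epsilon> k x = \<epsilon> k y" if "k \<in> {1..11}" for k
  proof -
    have "k = 1 \<or> k = 2 \<or> k = 3 \<or> k = 4 \<or> k = 5 \<or> k = 6 \<or> k = 7 \<or> k = 8 \<or> k = 9 \<or> k = 10 \<or> k = 11"
    proof -
      have "k \<in> set [1..<12]" using that by simp
      then show ?thesis by (simp add: upt_rec)
    qed
    then show ?thesis using R by (elim disjE) simp_all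
  qed
  then have "(\<Sum>k\<in>{1..11}. \<epsilon> k x *\<^sub>R e k) = (\<Sum>k\<in>{1..11}. \<epsilon> k y *\<^sub>R e k)"
    by (intro sum.cong) auto
  then show "x = y" using dual_basis_expansion[OF basis] by (simp add: dual)
qed simp

lemma lie_algebra: "lie_algebra br"
  unfolding lie_algebra_def
proof (intro conjI allI)
  fix x y z
  show "br x (br y z) + br y (br z x) + br z (br x y) = 0"
    unfolding eq_iff_coords by (simp add: eps_linear bracket algebra_simps)
qed (rule alternating)

lemma lower_central_step:
  assumes "subspace T" "\<And>x y. y \<in> lower_central br k \<Longrightarrow> br x y \<in> T"
  shows "lower_central br (Suc k) \<subseteq> T"
  unfolding lower_central.simps using assms by (intro span_minimal) auto

lemma lower_central_1: "lower_central br (Suc 0) \<subseteq> {x. \<epsilon> 1 x = 0 \<and> \<epsilon> 2 x = 0 \<and> \<epsilon> 4 x = 0}"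
  by (rule lower_central_step) (auto simp: subspace_def eps_linear bracket)

lemma lower_central_2:
  "lower_central br 2 \<subseteq> {x. \<epsilon> 1 x = 0 \<and> \<epsilon> 2 x = 0 \<and> \<epsilon> 3 x = 0 \<and> \<epsilon> 4 x = 0 \<and> \<epsilon> 5 x = 0}"
proof -
  have "lower_central br (Suc (Suc 0))
      \<subseteq> {x. \<epsilon> 1 x = 0 \<and> \<epsilon> 2 x = 0 \<and> \<epsilon> 3 x = 0 \<and> \<epsilon> 4 x = 0 \<and> \<epsilon> 5 x = 0}"
    by (rule lower_central_step)
      (use lower_central_1 in \<open>auto simp: subspace_def eps_linear bracket simp del: lower_central.simps\<close>)
  then show ?thesis by (simp only: numeral_2_eq_2)
qed

lemma lower_central_3:
  "lower_central br 3 \<subseteq> {x. \<epsilon> 1 x = 0 \<and> \<epsilon> 2 x = 0 \<and> \<epsilon> 3 x = 0 \<and> \<epsilon> 4 x = 0 \<and> \<epsilon> 5 x = 0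
     \<and> \<epsilon> 6 x = 0 \<and> \<epsilon> 7 x = 0}"
proof -
  have "lower_central br (Suc 2) \<subseteq> {x. \<epsilon> 1 x = 0 \<and> \<epsilon> 2 x = 0 \<and> \<epsilon> 3 x = 0 \<and> \<epsilon> 4 x = 0 \<and> \<epsilon> 5 x = 0
     \<and> \<epsilon> 6 x = 0 \<and> \<epsilon> 7 x = 0}"
    by (rule lower_central_step)
      (use lower_central_2 in \<open>auto simp: subspace_def eps_linear bracket\<close>)
  then show ?thesis by simp
qed

lemma lower_central_4:
  "lower_central br 4 \<subseteq> {x. \<epsilon> 1 x = 0 \<and> \<epsilon> 2 x = 0 \<and> \<epsilon> 3 x = 0 \<and> \<epsilon> 4 x = 0 \<and> \<epsilon> 5 x = 0
     \<and> \<epsilon> 6 x = 0 \<and> \<epsilon> 7 x = 0 \<and> \<epsilon> 8 x = 0 \<and> \<epsilon> 9 x = 0}"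
proof -
  have "lower_central br (Suc 3) \<subseteq> {x. \<epsilon> 1 x = 0 \<and> \<epsilon> 2 x = 0 \<and> \<epsilon> 3 x = 0 \<and> \<epsilon> 4 x = 0 \<and> \<epsilon> 5 x = 0
     \<and> \<epsilon> 6 x = 0 \<and> \<epsilon> 7 x = 0 \<and> \<epsilon> 8 x = 0 \<and> \<epsilon> 9 x = 0}"
    by (rule lower_central_step)
      (use lower_central_3 in \<open>auto simp: subspace_def eps_linear bracket\<close>)
  then show ?thesis by simp
qed

lemma nilpotent: "nilpotent_lie_algebra br"
proof -
  have "lower_central br (Suc 4) \<subseteq> {0}"
    by (rule lower_central_step)
      (use lower_central_4 in \<open>auto simp: eq_iff_coords[of _ 0] eps_linear bracket\<close>)
  moreover have "0 \<in> lower_central br (Suc 4)"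
    unfolding lower_central.simps by (rule span_zero)
  ultimately have "lower_central br (Suc 4) = {0}" by blast
  then show ?thesis unfolding nilpotent_lie_algebra_def using lie_algebra by blast
qed

section \<open>The ad-invariant metric\<close>

lemma metric:
  "ad_invariant_metric br (\<lambda>X Y.
          - sym_product (\<epsilon> 1) (\<epsilon> 11) X Y + sym_product (\<epsilon> 3) (\<epsilon> 8) X Y
          + sym_product (\<epsilon> 4) (\<epsilon> 9) X Y + sym_product (\<epsilon> 2) (\<epsilon> 10) X Y
          - 2 * tensor (\<epsilon> 5) (\<epsilon> 5) X Y + 2 * tensor (\<epsilon> 6) (\<epsilon> 6) X Y
          + tensor (\<epsilon> 7) (\<epsilon> 7) X Y)" (is "ad_invariant_metric br ?g")
  unfolding ad_invariant_metric_def
proof (intro conjI allI impI)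
  show "bilinear ?g"
    unfolding bilinear_def sym_product_def tensor_def
    by (auto intro!: linearI simp: eps_linear algebra_simps)
  show "?g X Y = ?g Y X" for X Y
    by (simp add: sym_product_def tensor_def algebra_simps)
  (* Pairing with each e k isolates one coordinate of X up to a nonzero factor. *)
  show "X = 0" if nondeg: "\<forall>Y. ?g X Y = 0" for X
  proof -
    have "?g X (e k) = 0" for k using nondeg by blast
    from this[of 1] this[of 2] this[of 3] this[of 4] this[of 5] this[of 6] this[of 7] this[of 8]
      this[of 9] this[of 10] this[of 11]
    show ?thesis
      unfolding eq_iff_coords[of X] by (simp add: sym_product_def tensor_def eps_linear eps_e)
  qed
  show "?g (br X Y) Z = - ?g Y (br X Z)" for X Y Z
    by (simp add: sym_product_def tensor_def bracket algebra_simps)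
qed

section \<open>There is no nice basis\<close>

lemma upper_central_1: "upper_central br (Suc 0) = {x. \<epsilon> 1 x = 0 \<and> \<epsilon> 2 x = 0 \<and> \<epsilon> 3 x = 0
    \<and> \<epsilon> 4 x = 0 \<and> \<epsilon> 5 x = 0 \<and> \<epsilon> 6 x = 0 \<and> \<epsilon> 7 x = 0 \<and> \<epsilon> 8 x = 0}" (is "_ = ?C")
proof (intro equalityI subsetI)
  fix x assume "x \<in> upper_central br (Suc 0)"
  then have "br y x = 0" for y by simp
  from this[of "e 1"] this[of "e 2"] this[of "e 3"] this[of "e 4"] show "x \<in> ?C"
    by (simp add: eq_iff_coords[of _ 0] bracket eps_linear eps_e)
next
  fix x assume "x \<in> ?C"
  then show "x \<in> upper_central br (Suc 0)"
    by (simp add: eq_iff_coords[of _ 0] bracket eps_linear)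
qed

lemma upper_central_2: "upper_central br (Suc (Suc 0)) = {x. \<epsilon> 1 x = 0 \<and> \<epsilon> 2 x = 0 \<and> \<epsilon> 3 x = 0
    \<and> \<epsilon> 4 x = 0 \<and> \<epsilon> 6 x = 0 \<and> \<epsilon> 7 x = 0}" (is "_ = ?C")
proof (intro equalityI subsetI)
  fix x assume "x \<in> upper_central br (Suc (Suc 0))"
  then have "br y x \<in> upper_central br (Suc 0)" for y by simp
  from this[of "e 1"] this[of "e 2"] this[of "e 3"] this[of "e 4"] show "x \<in> ?C"
    unfolding upper_central_1 by (simp add: bracket eps_linear eps_e)
next
  fix x assume "x \<in> ?C"
  then have "br y x \<in> upper_central br (Suc 0)" for y
    unfolding upper_central_1 by (simp add: bracket)
  then show "x \<in> upper_central br (Suc (Suc 0))" by simp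
qed

lemma upper_central_3: "upper_central br (Suc (Suc (Suc 0))) = {x. \<epsilon> 1 x = 0 \<and> \<epsilon> 2 x = 0
    \<and> \<epsilon> 3 x = 0 \<and> \<epsilon> 4 x = 0}" (is "_ = ?C")
proof (intro equalityI subsetI)
  fix x assume "x \<in> upper_central br (Suc (Suc (Suc 0)))"
  then have "br y x \<in> upper_central br (Suc (Suc 0))" for y by simp
  from this[of "e 1"] this[of "e 2"] this[of "e 3"] this[of "e 4"] show "x \<in> ?C"
    unfolding upper_central_2 by (simp add: bracket eps_linear eps_e)
next
  fix x assume "x \<in> ?C"
  then have "br y x \<in> upper_central br (Suc (Suc 0))" for y
    unfolding upper_central_2 by (simp add: bracket)
  then show "x \<in> upper_central br (Suc (Suc (Suc 0)))" by simp
qed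

lemma upper_central_4:
  "upper_central br (Suc (Suc (Suc (Suc 0)))) = {x. \<epsilon> 1 x = 0 \<and> \<epsilon> 2 x = 0}" (is "_ = ?C")
proof (intro equalityI subsetI)
  fix x assume "x \<in> upper_central br (Suc (Suc (Suc (Suc 0))))"
  then have "br y x \<in> upper_central br (Suc (Suc (Suc 0)))" for y by simp
  from this[of "e 1"] this[of "e 2"] show "x \<in> ?C"
    unfolding upper_central_3 by (simp add: bracket eps_linear eps_e)
next
  fix x assume "x \<in> ?C"
  then have "br y x \<in> upper_central br (Suc (Suc (Suc 0)))" for y
    unfolding upper_central_3 by (simp add: bracket)
  then show "x \<in> upper_central br (Suc (Suc (Suc (Suc 0))))" by simp
qed

lemma e6_e7_in_lower_central_2: "e 6 \<in> lower_central br 2" "e 7 \<in> lower_central br 2"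
proof -
  have "br (e 1) (e 2) = e 3"
    unfolding eq_iff_coords by (simp add: bracket eps_e)
  then have e3: "e 3 \<in> lower_central br (Suc 0)"
    by (metis (mono_tags, lifting) UNIV_I lower_central.simps mem_Collect_eq span_base)
  have gen: "br x (e 3) \<in> lower_central br 2" for x
    unfolding numeral_2_eq_2 lower_central.simps(2)[of br "Suc 0"]
    using e3 by (intro span_base) blast
  have "e 6 = br (- e 1) (e 3)" "e 7 = br (e 2) (e 3)"
    unfolding eq_iff_coords by (simp_all add: bracket eps_e eps_linear)
  then show "e 6 \<in> lower_central br 2" "e 7 \<in> lower_central br 2" using gen by metis+
qed

context
  fixes n f
  assumes nice: "nice_basis br n f"
begin

lemma nice_indexed_basis: "indexed_basis n f"
  using nice by (simp add: nice_basis_def)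

text \<open>Vanishing of the first four coordinates puts \<open>f k\<close> into the sum of the second term of the upper central series
  and \<open>lower_central br 2\<close>. Both are coordinate subspaces, so a basis element of the sum lies in one
  of the summands; a component along \<open>e 5\<close> excludes the lower central term.\<close>

lemma nice_basis_second_center_member:
  assumes k: "k \<in> {1..n}"
    and zero: "\<epsilon> 1 (f k) = 0" "\<epsilon> 2 (f k) = 0" "\<epsilon> 3 (f k) = 0" "\<epsilon> 4 (f k) = 0"
    and e5: "\<epsilon> 5 (f k) \<noteq> 0"
  shows "\<epsilon> 6 (f k) = 0" "\<epsilon> 7 (f k) = 0"
proof -
  define v where "v = \<epsilon> 6 (f k) *\<^sub>R e 6 + \<epsilon> 7 (f k) *\<^sub>R e 7"
  have v: "v \<in> lower_central br 2"
    using coordinate_subspace_lower_central[OF nice bilinear_bracket, of 2] e6_e7_in_lower_central_2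
    unfolding v_def coordinate_subspace_def by (simp add: subspace_add subspace_scale)
  have z: "f k - v \<in> upper_central br (Suc (Suc 0))"
    unfolding upper_central_2 v_def using zero by (simp add: eps_linear eps_e)
  have "dual_basis n f k (f k - v) + dual_basis n f k v = 1"
    using dual_basis_basis[OF nice_indexed_basis k k]
    by (simp add: linear_diff[OF linear_dual_basis[OF nice_indexed_basis]])
  moreover have "dual_basis n f k v = 0"
    using coordinate_subspace_lower_central[OF nice bilinear_bracket, of 2] v k e5 lower_central_2
    unfolding coordinate_subspace_def by blast
  ultimately have "f k \<in> upper_central br (Suc (Suc 0))"
    using coordinate_subspace_upper_central[OF nice bilinear_bracket, of "Suc (Suc 0)"] z k
    unfolding coordinate_subspace_def by (metis add_0_right zero_neq_one)
  then show "\<epsilon> 6 (f k) = 0" "\<epsilon> 7 (f k) = 0" unfolding upper_central_2 by auto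
qed

text \<open>The bracket \<open>[f p, f r]\<close> is a multiple of a basis element with a component along \<open>e 5\<close>. The two
  equations express that this basis element has no components along \<open>e 6\<close> and \<open>e 7\<close>.\<close>

lemma nice_basis_slope:
  assumes p: "p \<in> {1..n}" and r: "r \<in> {1..n}"
    and b: "\<epsilon> 2 (f p) \<noteq> 0" and r4: "\<epsilon> 1 (f r) = 0" "\<epsilon> 2 (f r) = 0" "\<epsilon> 4 (f r) \<noteq> 0"
  shows "\<epsilon> 2 (f p) * \<epsilon> 4 (f r) = 2 * \<epsilon> 1 (f p) * \<epsilon> 3 (f r)"
    and "\<epsilon> 2 (f p) * \<epsilon> 3 (f r) = \<epsilon> 1 (f p) * \<epsilon> 4 (f r)"
proof -
  obtain k c where k: "k \<in> {1..n}" and c: "br (f p) (f r) = c *\<^sub>R f k"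
    using nice p r unfolding nice_basis_def by blast
  have coords: "\<epsilon> i (br (f p) (f r)) = c * \<epsilon> i (f k)" for i
    unfolding c by (simp add: eps_linear)
  have "c * \<epsilon> 5 (f k) \<noteq> 0"
    unfolding coords[symmetric] using b r4 by (simp add: bracket)
  then have c0: "c \<noteq> 0" and "\<epsilon> 5 (f k) \<noteq> 0" by auto
  moreover have "\<epsilon> 1 (f k) = 0" "\<epsilon> 2 (f k) = 0" "\<epsilon> 3 (f k) = 0" "\<epsilon> 4 (f k) = 0"
    using c0 coords[of 1] coords[of 2] coords[of 3] coords[of 4] r4 by (auto simp: bracket)
  ultimately have "\<epsilon> 6 (f k) = 0" "\<epsilon> 7 (f k) = 0"
    using nice_basis_second_center_member[OF k] by auto
  then show "\<epsilon> 2 (f p) * \<epsilon> 4 (f r) = 2 * \<epsilon> 1 (f p) * \<epsilon> 3 (f r)"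
    "\<epsilon> 2 (f p) * \<epsilon> 3 (f r) = \<epsilon> 1 (f p) * \<epsilon> 4 (f r)"
    using coords[of 6] coords[of 7] r4 by (simp_all add: bracket)
qed

lemma no_nice_basis: False
proof -
  note bas = nice_indexed_basis
  have "e 4 \<in> upper_central br (Suc (Suc (Suc (Suc 0))))"
    unfolding upper_central_4 by (simp add: eps_e)
  moreover obtain r where r: "r \<in> {1..n}" "dual_basis n f r (e 4) \<noteq> 0" and c0: "\<epsilon> 4 (f r) \<noteq> 0"
    by (rule linear_nonzero_on_basis[OF bas linear_eps, of 4 "e 4"]) (auto simp: eps_e)
  ultimately have "f r \<in> upper_central br (Suc (Suc (Suc (Suc 0))))"
    using coordinate_subspace_upper_central[OF nice bilinear_bracket] unfolding coordinate_subspace_def by blast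
  then have r12: "\<epsilon> 1 (f r) = 0" "\<epsilon> 2 (f r) = 0" unfolding upper_central_4 by auto
  obtain p where p: "p \<in> {1..n}" and b0: "\<epsilon> 2 (f p) \<noteq> 0"
    by (rule linear_nonzero_on_basis[OF bas linear_eps, of 2 "e 2"]) (auto simp: eps_e)
  define a b c u where "a = \<epsilon> 1 (f p)" and "b = \<epsilon> 2 (f p)" and "c = \<epsilon> 4 (f r)" and "u = \<epsilon> 3 (f r)"
  have slope: "b * c = 2 * a * u" "b * u = a * c"
    using nice_basis_slope[OF p r(1) b0 r12 c0] by (simp_all add: a_def b_def c_def u_def)
  have u0: "u \<noteq> 0" using slope(1) b0 c0 by (auto simp: b_def c_def)
  (* This functional measures independence of f p on the components along e 1 and e 2. *)
  have lin: "linear (\<lambda>x. a * \<epsilon> 2 x - b * \<epsilon> 1 x)"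
    by (rule linearI) (simp_all add: eps_linear algebra_simps)
  obtain q where q: "q \<in> {1..n}" and ind: "a * \<epsilon> 2 (f q) - b * \<epsilon> 1 (f q) \<noteq> 0"
    by (rule linear_nonzero_on_basis[OF bas lin, of "e 1"]) (use b0 in \<open>auto simp: eps_e b_def\<close>)
  have q2: "\<epsilon> 2 (f q) = 0"
  proof (rule ccontr)
    assume q0: "\<epsilon> 2 (f q) \<noteq> 0"
    have "\<epsilon> 2 (f q) * u = \<epsilon> 1 (f q) * c"
      using nice_basis_slope[OF q r(1) q0 r12 c0] by (simp add: c_def u_def)
    then have "c * (a * \<epsilon> 2 (f q) - b * \<epsilon> 1 (f q)) = 0"
      using slope(2) by algebra
    then show False using ind c0 by (simp add: c_def)
  qed
  define a' where "a' = \<epsilon> 1 (f q)"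
  have a'0: "a' \<noteq> 0" using ind q2 by (auto simp: a'_def)
  obtain s k where s: "s \<in> {1..n}" and k: "br (f p) (f q) = k *\<^sub>R f s"
    using nice p q unfolding nice_basis_def by blast
  have coords: "k * \<epsilon> i (f s) = \<epsilon> i (br (f p) (f q))" for i
    unfolding k by (simp add: eps_linear)
  have "k * \<epsilon> 3 (f s) \<noteq> 0"
    unfolding coords using b0 a'0 q2 by (simp add: bracket a'_def)
  then have k0: "k \<noteq> 0" and t0: "\<epsilon> 3 (f s) \<noteq> 0" by auto
  have s0: "\<epsilon> 1 (f s) = 0" "\<epsilon> 2 (f s) = 0" "\<epsilon> 4 (f s) = 0"
    using coords[of 1] coords[of 2] coords[of 4] k0 by (simp_all add: bracket)
  define t where "t = \<epsilon> 3 (f s)"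
  obtain i ci where i: "i \<in> {1..n}" and ci: "br (f q) (f s) = ci *\<^sub>R f i"
    using nice q s unfolding nice_basis_def by blast
  obtain j cj where j: "j \<in> {1..n}" and cj: "br (f q) (f r) = cj *\<^sub>R f j"
    using nice q r unfolding nice_basis_def by blast
  obtain l cl where l: "l \<in> {1..n}" and cl: "br (f p) (f s) = cl *\<^sub>R f l"
    using nice p s unfolding nice_basis_def by blast
  have ei: "ci * \<epsilon> m (f i) = \<epsilon> m (br (f q) (f s))" for m unfolding ci by (simp add: eps_linear)
  have ej: "cj * \<epsilon> m (f j) = \<epsilon> m (br (f q) (f r))" for m unfolding cj by (simp add: eps_linear)
  have el: "cl * \<epsilon> m (f l) = \<epsilon> m (br (f p) (f s))" for m unfolding cl by (simp add: eps_linear)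
  have i6: "ci * \<epsilon> 6 (f i) \<noteq> 0" and i7: "ci * \<epsilon> 7 (f i) = 0"
    unfolding ei using s0 q2 a'0 t0 by (simp_all add: bracket a'_def)
  have j7: "cj * \<epsilon> 7 (f j) \<noteq> 0"
    unfolding ej using q2 a'0 c0 r12 by (simp add: bracket a'_def)
  have l7: "cl * \<epsilon> 7 (f l) \<noteq> 0"
    unfolding el using s0 b0 t0 by (simp add: bracket)
  have ne: "i \<noteq> j" "i \<noteq> l" using i6 i7 j7 l7 by auto
  (* The coefficients solve the linear relation between the (e 6, e 7) components
     (- a' t, 0), (- a' u, - a' c) and (- a t, b t) of the three brackets, using b u = a c. *)
  define x where "x = (- 2 * b * u) *\<^sub>R br (f q) (f s) + (b * t) *\<^sub>R br (f q) (f r)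
    + (a' * c) *\<^sub>R br (f p) (f s)"
  have "x \<in> upper_central br (Suc (Suc 0))"
  proof -
    have "\<epsilon> 6 x = a' * t * (b * u - a * c)"
      using q2 s0 r12
      by (simp add: x_def eps_linear bracket a_def b_def c_def u_def a'_def t_def algebra_simps)
    moreover have "\<epsilon> 7 x = 0"
      using q2 s0 r12
      by (simp add: x_def eps_linear bracket a_def b_def c_def u_def a'_def t_def algebra_simps)
    moreover have "\<epsilon> 1 x = 0" "\<epsilon> 2 x = 0" "\<epsilon> 3 x = 0" "\<epsilon> 4 x = 0"
      using q2 s0 r12 by (simp_all add: x_def eps_linear bracket)
    ultimately show ?thesis unfolding upper_central_2 using slope(2) by simp
  qed
  moreover have "dual_basis n f i x \<noteq> 0"
  proof -
    have "dual_basis n f i x = - 2 * b * u * ci"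
      unfolding x_def ci cj cl
      using dual_basis_basis[OF bas i i] dual_basis_basis[OF bas j i] dual_basis_basis[OF bas l i] ne
      by (simp add: linear_add[OF linear_dual_basis[OF bas]] linear_scale[OF linear_dual_basis[OF bas]]
          linear_diff[OF linear_dual_basis[OF bas]] linear_neg[OF linear_dual_basis[OF bas]])
    then show ?thesis using b0 u0 i6 by (simp add: b_def)
  qed
  ultimately have "f i \<in> upper_central br (Suc (Suc 0))"
    using coordinate_subspace_upper_central[OF nice bilinear_bracket] i unfolding coordinate_subspace_def by blast
  then show False using i6 unfolding upper_central_2 by simp
qed

end

end

theorem proposition1p1:
  fixes br :: "'a::real_vector \<Rightarrow> 'a \<Rightarrow> 'a"
    and e :: "nat \<Rightarrow> 'a"
    and \<epsilon> :: "nat \<Rightarrow> 'a \<Rightarrow> real"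
    and w :: "nat \<Rightarrow> nat \<Rightarrow> 'a \<Rightarrow> 'a \<Rightarrow> real"
    and d :: "('a \<Rightarrow> real) \<Rightarrow> 'a \<Rightarrow> 'a \<Rightarrow> real"
  assumes br: "alternating_bracket br"
    and basis: "indexed_basis 11 e"
    and dual: "\<epsilon> = dual_basis 11 e"
    and w: "w = (\<lambda>i j. wedge (\<epsilon> i) (\<epsilon> j))"
    and d: "d = ce_diff br"
    and d1: "d (\<epsilon> 1) = (\<lambda>X Y. 0)"
    and d2: "d (\<epsilon> 2) = (\<lambda>X Y. 0)"
    and d3: "d (\<epsilon> 3) = (\<lambda>X Y. - w 1 2 X Y)"
    and d4: "d (\<epsilon> 4) = (\<lambda>X Y. 0)"
    and d5: "d (\<epsilon> 5) = (\<lambda>X Y. 1/2 * w 2 4 X Y)"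
    and d6: "d (\<epsilon> 6) = (\<lambda>X Y. w 1 3 X Y - 1/2 * w 2 4 X Y)"
    and d7: "d (\<epsilon> 7) = (\<lambda>X Y. w 1 4 X Y - w 2 3 X Y)"
    and d8: "d (\<epsilon> 8) = (\<lambda>X Y. - 2 * w 1 6 X Y + w 2 7 X Y)"
    and d9: "d (\<epsilon> 9) = (\<lambda>X Y. w 2 6 X Y - w 1 7 X Y + w 2 5 X Y)"
    and d10: "d (\<epsilon> 10) = (\<lambda>X Y. w 1 8 X Y - w 4 6 X Y - w 3 7 X Y - w 4 5 X Y)"
    and d11: "d (\<epsilon> 11) = (\<lambda>X Y. w 2 8 X Y - 2 * w 3 6 X Y - w 4 7 X Y)"
  shows "nilpotent_lie_algebra br
    \<and> ad_invariant_metric br (\<lambda>X Y.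
          - sym_product (\<epsilon> 1) (\<epsilon> 11) X Y + sym_product (\<epsilon> 3) (\<epsilon> 8) X Y
          + sym_product (\<epsilon> 4) (\<epsilon> 9) X Y + sym_product (\<epsilon> 2) (\<epsilon> 10) X Y
          - 2 * tensor (\<epsilon> 5) (\<epsilon> 5) X Y + 2 * tensor (\<epsilon> 6) (\<epsilon> 6) X Y
          + tensor (\<epsilon> 7) (\<epsilon> 7) X Y)
    \<and> \<not> (\<exists>n f. nice_basis br n f)"
proof -
  have diff: "\<epsilon> k (br x y) = - d (\<epsilon> k) x y" for k x y
    by (simp add: d ce_diff_def)
  interpret metric_lie_algebra_11 br e \<epsilon>
    by unfold_locales
      (simp_all only: br basis dual[symmetric] diff d1 d2 d3 d4 d5 d6 d7 d8 d9 d10 d11,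
        simp_all add: w wedge_def tensor_def algebra_simps)
  show ?thesis using nilpotent metric no_nice_basis by blast
qed

end
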